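(* Let $n\geq 2$ and let $\delta_n=(n-2,n-3,\dots,1,0,0)\in\mathbb{N}^n$. Let $P_{\delta_n}\subset\mathbb{R}^n$ be the convex hull of the $S_n$-orbit of $\delta_n$ (under permutation of coordinates), and let $\gamma_n$ be the permutation representation of $S_n$ on the finite set $\mathrm{Lat}(P_{\delta_n})=P_{\delta_n}\cap\mathbb{Z}^n$ given by permuting coordinates. Then the restriction of $\gamma_n$ from $S_n$ to $S_{n-1}$ is isomorphic to the parking function representation $\mathrm{Park}_{n-1}$.
   Context: A parking function of length $k$ is a sequence $(a_1,\dots,a_k)$ of positive integers whose nondecreasing rearrangement $b_1\le\cdots\le b_k$ satisfies $b_i\le i$ for all $i$. The parking function representation $\mathrm{Park}_{k}$ is the permutation representation of $S_k$ on the set of parking functions of length $k$ by permuting entries. $S_{n-1}\subset S_n$ is the stabilizer of $n$. *)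

theory Defs
  imports
    "HOL-Analysis.Convex"
    "HOL-Library.Function_Algebras"
    "HOL-Algebra.Group_Action"
    "HOL-Algebra.Sym_Groups"
begin

text \<open>
  The group S_n is \<open>sym_group n\<close>, acting on \<open>{1..n}\<close>. A point of R^n is a function
  \<open>nat \<Rightarrow> real\<close> that vanishes outside \<open>{1..n}\<close>; such functions form a real vector space under
  the pointwise operations, so that the library's convex hull applies to them.
\<close>

instantiation "fun" :: (type, real_vector) real_vector
begin

definition "r *\<^sub>R f = (\<lambda>x. r *\<^sub>R f x)"

instance
  by standard (simp_all add: scaleR_fun_def fun_eq_iff algebra_simps)

end

lemma scaleR_fun_apply [simp]: "(r *\<^sub>R f) x = r *\<^sub>R f x"
  by (simp add: scaleR_fun_def)


subsection \<open>Complex representations\<close>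

definition cscale :: "complex \<Rightarrow> ('x \<Rightarrow> complex) \<Rightarrow> 'x \<Rightarrow> complex"
  where "cscale c f = (\<lambda>x. c * f x)"

interpretation cfun: vector_space cscale
  by standard (simp_all add: cscale_def fun_eq_iff algebra_simps)

text \<open>All representation spaces considered here are subspaces of spaces of complex functions.\<close>

record ('g, 'x) rep =
  rep_group :: "'g monoid"
  rep_space :: "('x \<Rightarrow> complex) set"
  rep_act :: "'g \<Rightarrow> ('x \<Rightarrow> complex) \<Rightarrow> ('x \<Rightarrow> complex)"

definition representation :: "('g, 'x) rep \<Rightarrow> bool"
  where "representation R \<longleftrightarrow>
    group (rep_group R) \<and> cfun.subspace (rep_space R) \<and>
    (\<forall>g\<in>carrier (rep_group R). \<forall>u\<in>rep_space R. rep_act R g u \<in> rep_space R) \<and>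
    (\<forall>g\<in>carrier (rep_group R). \<forall>u\<in>rep_space R. \<forall>v\<in>rep_space R.
      rep_act R g (u + v) = rep_act R g u + rep_act R g v) \<and>
    (\<forall>g\<in>carrier (rep_group R). \<forall>c. \<forall>u\<in>rep_space R.
      rep_act R g (cscale c u) = cscale c (rep_act R g u)) \<and>
    (\<forall>u\<in>rep_space R. rep_act R \<one>\<^bsub>rep_group R\<^esub> u = u) \<and>
    (\<forall>g\<in>carrier (rep_group R). \<forall>h\<in>carrier (rep_group R). \<forall>u\<in>rep_space R.
      rep_act R (g \<otimes>\<^bsub>rep_group R\<^esub> h) u = rep_act R g (rep_act R h u))"

definition restrict_rep :: "'g set \<Rightarrow> ('g, 'x) rep \<Rightarrow> ('g, 'x) rep"
  where "restrict_rep H R = R\<lparr>rep_group := (rep_group R)\<lparr>carrier := H\<rparr>\<rparr>"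

definition rep_isomorphic :: "('g, 'x) rep \<Rightarrow> ('g, 'y) rep \<Rightarrow> bool"
  where "rep_isomorphic R S \<longleftrightarrow>
    representation R \<and> representation S \<and> rep_group R = rep_group S \<and>
    (\<exists>T. bij_betw T (rep_space R) (rep_space S) \<and>
      (\<forall>u\<in>rep_space R. \<forall>v\<in>rep_space R. T (u + v) = T u + T v) \<and>
      (\<forall>c. \<forall>u\<in>rep_space R. T (cscale c u) = cscale c (T u)) \<and>
      (\<forall>g\<in>carrier (rep_group R). \<forall>u\<in>rep_space R.
        T (rep_act R g u) = rep_act S g (T u)))"

text \<open>
  The complex vector space with basis a finite set \<open>X\<close> is realised as the space of functions
  vanishing outside \<open>X\<close>, the basis vector of \<open>x\<close> being the indicator of \<open>{x}\<close>. The action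
  below is the linear extension of \<open>\<phi>\<close>, see \<open>perm_rep_basis\<close>.
\<close>

definition perm_rep :: "'g monoid \<Rightarrow> 'x set \<Rightarrow> ('g \<Rightarrow> 'x \<Rightarrow> 'x) \<Rightarrow> ('g, 'x) rep"
  where "perm_rep G X \<phi> =
    \<lparr>rep_group = G,
     rep_space = {f. \<forall>x. x \<notin> X \<longrightarrow> f x = 0},
     rep_act = \<lambda>g f x. if x \<in> X then f (\<phi> (inv\<^bsub>G\<^esub> g) x) else 0\<rparr>"

lemma perm_rep_basis:
  assumes "group_action G X \<phi>" "g \<in> carrier G" "x \<in> X"
  shows "rep_act (perm_rep G X \<phi>) g (\<lambda>y. if y = x then 1 else 0)
       = (\<lambda>y. if y = \<phi> g x then 1 else 0)"
proof -
  interpret group_action G X \<phi> by fact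
  interpret G: group G using group_hom by (rule group_hom.axioms(1))
  have "(\<phi> (inv\<^bsub>G\<^esub> g) y = x) = (y = \<phi> g x)" if y: "y \<in> X" for y
  proof
    assume "\<phi> (inv\<^bsub>G\<^esub> g) y = x"
    from orbit_sym_aux[OF G.inv_closed[OF assms(2)] y this] assms(2)
    show "y = \<phi> g x" by simp
  next
    assume "y = \<phi> g x"
    from orbit_sym_aux[OF assms(2,3) this[symmetric]]
    show "\<phi> (inv\<^bsub>G\<^esub> g) y = x" .
  qed
  then show ?thesis
    using element_image[OF assms(2,3)] by (auto simp: perm_rep_def fun_eq_iff)
qed

lemma representation_perm_rep:
  assumes "group_action G X \<phi>"
  shows "representation (perm_rep G X \<phi>)"
proof -
  interpret group_action G X \<phi> by fact
  interpret G: group G using group_hom by (rule group_hom.axioms(1))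
  have 1: "\<phi> \<one>\<^bsub>G\<^esub> x = x" if "x \<in> X" for x
    using that id_eq_one by (metis restrict_apply')
  have 2: "\<phi> (inv\<^bsub>G\<^esub> (g \<otimes>\<^bsub>G\<^esub> h)) x = \<phi> (inv\<^bsub>G\<^esub> h) (\<phi> (inv\<^bsub>G\<^esub> g) x)"
    if "g \<in> carrier G" "h \<in> carrier G" "x \<in> X" for g h x
    using that composition_rule[of x "inv\<^bsub>G\<^esub> h" "inv\<^bsub>G\<^esub> g"] by (simp add: G.inv_mult_group)
  have 3: "\<phi> (inv\<^bsub>G\<^esub> g) x \<in> X" if "g \<in> carrier G" "x \<in> X" for g x
    using that element_image[of "inv\<^bsub>G\<^esub> g" x] by simp
  show ?thesis
    unfolding representation_def perm_rep_def cfun.subspace_def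
    by (auto simp: fun_eq_iff cscale_def 1 2 3 G.is_group)
qed

lemma representation_restrict_rep:
  assumes "representation R" "subgroup H (rep_group R)"
  shows "representation (restrict_rep H R)"
proof -
  have "H \<subseteq> carrier (rep_group R)" by (rule subgroup.subset[OF assms(2)])
  moreover have "group ((rep_group R)\<lparr>carrier := H\<rparr>)"
    using assms by (simp add: representation_def subgroup.subgroup_is_group)
  ultimately show ?thesis
    using assms(1) unfolding representation_def restrict_rep_def by (simp add: subset_iff)
qed


lemma group_stabilizer_sym_group:
  assumes "n \<ge> 1"
  shows "(sym_group n)\<lparr>carrier := stabilizer (sym_group n) (\<lambda>p. p) n\<rparr> = sym_group (n - 1)"
proof -
  have "(p permutes {1..n} \<and> p n = n) = (p permutes {1..n - 1})" for p
  proof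
    assume p: "p permutes {1..n} \<and> p n = n"
    have "p permutes {1..n} - {n}"
    proof (rule permutes_superset)
      show "p permutes {1..n}" using p by blast
      show "p x = x" if "x \<in> {1..n} - ({1..n} - {n})" for x using that p by blast
    qed
    moreover have "{1..n} - {n} = {1..n - 1}" by auto
    ultimately show "p permutes {1..n - 1}" by simp
  next
    assume p: "p permutes {1..n - 1}"
    have "p permutes {1..n}" by (rule permutes_subset[OF p]) auto
    then show "p permutes {1..n} \<and> p n = n"
      using permutes_not_in[OF p, of n] assms by simp
  qed
  then show ?thesis
    by (simp add: sym_group_def stabilizer_def)
qed


subsection \<open>Permutation of coordinates\<close>

text \<open>
  The left action on sequences indexed by \<open>{1..n}\<close>: the entry at position \<open>i\<close> moves to
  position \<open>p i\<close>. The restriction to \<open>X\<close> is required by the library's group actions.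
\<close>

definition coord_action :: "(nat \<Rightarrow> 'a) set \<Rightarrow> (nat \<Rightarrow> nat) \<Rightarrow> (nat \<Rightarrow> 'a) \<Rightarrow> (nat \<Rightarrow> 'a)"
  where "coord_action X p = (\<lambda>x\<in>X. x \<circ> inv' p)"

lemma group_action_coord_action:
  assumes "\<And>p x. p permutes {1..n} \<Longrightarrow> x \<in> X \<Longrightarrow> x \<circ> p \<in> X"
  shows "group_action (sym_group n) X (coord_action X)"
proof -
  have cl: "x \<circ> inv' p \<in> X" if "p permutes {1..n}" "x \<in> X" for p x
    using assms[OF permutes_inv[OF that(1)] that(2)] .
  have bij: "coord_action X p \<in> Bij X" if p: "p permutes {1..n}" for p
  proof -
    have "bij_betw (coord_action X p) X X"
      by (rule bij_betw_byWitness[where f' = "\<lambda>x. x \<circ> p"])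
        (auto simp: coord_action_def cl[OF p] assms[OF p] comp_assoc
          permutes_inv_o[OF p])
    then show ?thesis by (simp add: Bij_def coord_action_def)
  qed
  have "coord_action X (p \<circ> q) = compose X (coord_action X p) (coord_action X q)"
    if "p permutes {1..n}" "q permutes {1..n}" for p q
    using that cl by (auto simp: coord_action_def compose_def fun_eq_iff restrict_def
        o_inv_distrib permutes_bij)
  then have "coord_action X \<in> hom (sym_group n) (BijGroup X)"
    using bij by (auto simp: hom_def BijGroup_def sym_group_def)
  then show ?thesis
    by (simp add: group_action_def group_hom_def group_hom_axioms_def sym_group_is_group
        group_BijGroup)
qed


subsection \<open>Lattice points of the permutohedron\<close>

text \<open>\<open>\<delta>\<^sub>n = (n-2, n-3, \<dots>, 1, 0, 0)\<close>, with value 0 outside \<open>{1..n}\<close>.\<close>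

definition delta :: "nat \<Rightarrow> nat \<Rightarrow> real"
  where "delta n i = (if 1 \<le> i \<and> i \<le> n - 1 then real (n - 1 - i) else 0)"

definition delta_polytope :: "nat \<Rightarrow> (nat \<Rightarrow> real) set"
  where "delta_polytope n = convex hull (orbit (sym_group n) (coord_action UNIV) (delta n))"

definition Lat :: "(nat \<Rightarrow> real) set \<Rightarrow> (nat \<Rightarrow> real) set"
  where "Lat P = {x \<in> P. \<forall>i. x i \<in> \<int>}"

definition gamma_rep :: "nat \<Rightarrow> (nat \<Rightarrow> nat, nat \<Rightarrow> real) rep"
  where "gamma_rep n =
    perm_rep (sym_group n) (Lat (delta_polytope n)) (coord_action (Lat (delta_polytope n)))"

lemma delta_polytope_eq:
  "delta_polytope n = convex hull {delta n \<circ> p |p. p permutes {1..n}}"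
proof -
  have "{delta n \<circ> inv' p |p. p permutes {1..n}} = {delta n \<circ> p |p. p permutes {1..n}}"
  proof (intro equalityI subsetI)
    fix x assume "x \<in> {delta n \<circ> inv' p |p. p permutes {1..n}}"
    then show "x \<in> {delta n \<circ> p |p. p permutes {1..n}}"
      using permutes_inv by blast
  next
    fix x assume "x \<in> {delta n \<circ> p |p. p permutes {1..n}}"
    then obtain p where p: "p permutes {1..n}" "x = delta n \<circ> p" by blast
    have "x = delta n \<circ> inv' (inv' p)" using p by (simp add: permutes_inv_inv)
    then show "x \<in> {delta n \<circ> inv' p |p. p permutes {1..n}}"
      using permutes_inv[OF p(1)] by blast
  qed
  then show ?thesis
    by (simp add: delta_polytope_def orbit_def coord_action_def sym_group_def)
qed

lemma delta_polytope_permute: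
  assumes "p permutes {1..n}" "x \<in> delta_polytope n"
  shows "x \<circ> p \<in> delta_polytope n"
proof -
  let ?S = "{delta n \<circ> p |p. p permutes {1..n}}"
  have "linear (\<lambda>x :: nat \<Rightarrow> real. x \<circ> p)"
    by standard (simp_all add: fun_eq_iff)
  then have "(\<lambda>x. x \<circ> p) ` (convex hull ?S) = convex hull ((\<lambda>x. x \<circ> p) ` ?S)"
    by (rule convex_hull_linear_image)
  moreover have "(\<lambda>x. x \<circ> p) ` ?S \<subseteq> ?S"
    using permutes_compose[OF assms(1)] by (auto simp: comp_assoc)
  ultimately show ?thesis
    using assms(2) hull_mono[of "(\<lambda>x. x \<circ> p) ` ?S" ?S convex]
    unfolding delta_polytope_eq by blast
qed

lemma finite_Lat: "finite (Lat (delta_polytope n))"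
proof -
  let ?B = "{x :: nat \<Rightarrow> real. \<forall>i. 0 \<le> x i \<and> x i \<le> n \<and> (i \<notin> {1..n} \<longrightarrow> x i = 0)}"
  have "convex ?B"
  proof (rule convexI)
    fix x y :: "nat \<Rightarrow> real" and u v :: real
    assume xy: "x \<in> ?B" "y \<in> ?B" and uv: "0 \<le> u" "0 \<le> v" "u + v = 1"
    have "u * x i + v * y i \<le> n" for i
      by (rule convex_bound_le) (use xy uv in auto)
    then show "u *\<^sub>R x + v *\<^sub>R y \<in> ?B"
      using xy uv by auto
  qed
  moreover have "{delta n \<circ> p |p. p permutes {1..n}} \<subseteq> ?B"
    by (auto simp: delta_def permutes_def)
  ultimately have "delta_polytope n \<subseteq> ?B"
    unfolding delta_polytope_eq by (simp add: hull_minimal)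
  then have "Lat (delta_polytope n) \<subseteq>
      {f. \<forall>i. (i \<in> {1..n} \<longrightarrow> f i \<in> real ` {0..n}) \<and> (i \<notin> {1..n} \<longrightarrow> f i = 0)}"
  proof -
    have "r \<in> real ` {0..n}" if "0 \<le> r" "r \<le> n" "r \<in> \<int>" for r :: real
    proof -
      have "r \<in> \<nat>" using that by (simp add: Nats_altdef2)
      then show ?thesis using that by (auto elim!: Nats_cases)
    qed
    then show ?thesis
      using \<open>delta_polytope n \<subseteq> ?B\<close> unfolding Lat_def by blast
  qed
  moreover have "finite \<dots>"
    by (rule finite_set_of_finite_funs) auto
  ultimately show ?thesis by (rule finite_subset)
qed

lemma representation_gamma_rep: "representation (gamma_rep n)"
  unfolding gamma_rep_def
  by (intro representation_perm_rep group_action_coord_action)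
    (auto simp: Lat_def intro: delta_polytope_permute)


subsection \<open>Parking functions\<close>

text \<open>
  A parking function of length \<open>k\<close> is encoded as a function with value 0 outside \<open>{1..k}\<close>.
  Lists are indexed from 0, so the \<open>i\<close>-th entry of the rearrangement is at index \<open>i - 1\<close>.
\<close>

definition parking_functions :: "nat \<Rightarrow> (nat \<Rightarrow> nat) set"
  where "parking_functions k =
    {a. (\<forall>i\<in>{1..k}. 1 \<le> a i) \<and> (\<forall>i. i \<notin> {1..k} \<longrightarrow> a i = 0) \<and>
        (\<forall>i\<in>{1..k}. sort (map a [1..<k + 1]) ! (i - 1) \<le> i)}"

definition Park :: "nat \<Rightarrow> (nat \<Rightarrow> nat, nat \<Rightarrow> nat) rep"
  where "Park k = perm_rep (sym_group k) (parking_functions k) (coord_action (parking_functions k))"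

lemma parking_functions_permute:
  assumes p: "p permutes {1..k}" and "a \<in> parking_functions k"
  shows "a \<circ> p \<in> parking_functions k"
proof -
  have sort_eq: "sort (map (a \<circ> p) [1..<k + 1]) = sort (map a [1..<k + 1])"
  proof (rule properties_for_sort)
    have "image_mset p (mset_set {1..k}) = mset_set {1..k}"
      by (simp only: image_mset_mset_set[OF permutes_inj_on[OF p]] permutes_image[OF p])
    moreover have "mset [1..<k + 1] = mset_set {1..k}"
      by (simp only: mset_upt Suc_eq_plus1[symmetric] atLeastLessThanSuc_atLeastAtMost)
    ultimately have "mset (map (a \<circ> p) [1..<k + 1]) = mset (map a [1..<k + 1])"
      by (simp only: mset_map flip: multiset.map_comp)
    then show "mset (sort (map a [1..<k + 1])) = mset (map (a \<circ> p) [1..<k + 1])"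
      by (simp only: mset_sort)
  qed (rule sorted_sort)
  have p_in: "p i \<in> {1..k} \<longleftrightarrow> i \<in> {1..k}" for i
    by (rule permutes_in_image[OF p])
  have "1 \<le> a (p i)" if "i \<in> {1..k}" for i
    using assms(2) that p_in[of i] unfolding parking_functions_def by blast
  moreover have "a (p i) = 0" if "i \<notin> {1..k}" for i
    using assms(2) that p_in[of i] unfolding parking_functions_def by blast
  moreover have "sort (map (a \<circ> p) [1..<k + 1]) ! (i - 1) \<le> i" if "i \<in> {1..k}" for i
    using assms(2) that unfolding parking_functions_def sort_eq by blast
  ultimately show ?thesis
    unfolding parking_functions_def mem_Collect_eq comp_apply by blast
qed

lemma representation_Park: "representation (Park k)"
  unfolding Park_def
  by (intro representation_perm_rep group_action_coord_action parking_functions_permute)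

lemma finite_parking_functions: "finite (parking_functions k)"
proof -
  have "a i \<le> k" if a: "a \<in> parking_functions k" and i: "i \<in> {1..k}" for a i
  proof -
    let ?b = "sort (map a [1..<k + 1])"
    have "set ?b = a ` {1..k}"
      by (simp only: set_sort set_map set_upt Suc_eq_plus1[symmetric]
          atLeastLessThanSuc_atLeastAtMost)
    then have "a i \<in> set ?b" using i by blast
    then obtain j where j: "j < length ?b" "?b ! j = a i" unfolding in_set_conv_nth by blast
    have "Suc j \<in> {1..k}" using j(1) by (simp del: upt_Suc)
    then have "?b ! (Suc j - 1) \<le> Suc j"
      using a unfolding parking_functions_def by blast
    then have "a i \<le> Suc j" by (simp only: j(2) diff_Suc_1)
    also have "Suc j \<le> k" using j(1) by (simp del: upt_Suc)
    finally show ?thesis .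
  qed
  moreover have "\<forall>a\<in>parking_functions k. \<forall>i. i \<notin> {1..k} \<longrightarrow> a i = 0"
    unfolding parking_functions_def by blast
  ultimately have "parking_functions k \<subseteq>
      {f. \<forall>i. (i \<in> {1..k} \<longrightarrow> f i \<in> {0..k}) \<and> (i \<notin> {1..k} \<longrightarrow> f i = 0)}"
    by (simp add: subset_iff)
  moreover have "finite \<dots>"
    by (rule finite_set_of_finite_funs) auto
  ultimately show ?thesis by (rule finite_subset)
qed

end

theory Submission
  imports Defs "HOL-Number_Theory.Cong"
begin

text \<open>
  Forgetting the last coordinate identifies, as \<open>S\<^bsub>n-1\<^esub>\<close>-sets, the vectors over \<open>\<int>/n\<close> with
  prescribed coordinate sum modulo the diagonal with \<open>(\<int>/n)\<^bsup>n-1\<^esup>\<close> modulo the diagonal. Each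
  class of the former contains exactly one lattice point of the permutohedron, the vector with the
  smallest sum of squares among those in \<open>\<int>\<^sup>n\<close> with the coordinate sum of \<open>\<delta>\<^sub>n\<close>. Each class
  of the latter contains exactly one parking function, the one with the smallest sum of residues.
  By uniqueness the resulting bijection is equivariant.
\<close>

subsection \<open>Isomorphisms of permutation representations\<close>

text \<open>The linear extension of \<open>F\<close> to spaces of functions is pullback along its
  inverse, \<open>T\<close> in the proof, and equivariance passes from \<open>F\<close> to
  \<open>T\<close>. The target group is written as \<open>G\<close> with carrier \<open>H\<close>
  because \<open>rep_isomorphic\<close> asks for equal groups.\<close>

lemma rep_isomorphic_restrict_perm_rep:
  assumes X: "group_action G X \<phi>" and H: "subgroup H G"
    and Y: "group_action (G\<lparr>carrier := H\<rparr>) Y \<psi>"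
    and F: "bij_betw F X Y"
    and eq: "\<And>h x. h \<in> H \<Longrightarrow> x \<in> X \<Longrightarrow> F (\<phi> h x) = \<psi> h (F x)"
  shows "rep_isomorphic (restrict_rep H (perm_rep G X \<phi>)) (perm_rep (G\<lparr>carrier := H\<rparr>) Y \<psi>)"
proof -
  interpret X: group_action G X \<phi> by fact
  interpret Y: group_action "G\<lparr>carrier := H\<rparr>" Y \<psi> by fact
  interpret G: group G using X.group_hom by (rule group_hom.axioms(1))
  have "subgroup H (rep_group (perm_rep G X \<phi>))" using H by (simp add: perm_rep_def)
  then have rX: "representation (restrict_rep H (perm_rep G X \<phi>))"
    by (intro representation_restrict_rep representation_perm_rep X)
  define F' where "F' = inv_into X F"
  have F'X: "F' y \<in> X" and FF': "F (F' y) = y" if "y \<in> Y" for y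
    using that F by (auto simp: F'_def bij_betw_def inv_into_into f_inv_into_f)
  have FY: "F x \<in> Y" and F'F: "F' (F x) = x" if "x \<in> X" for x
    using that F by (auto simp: F'_def bij_betw_def)
  define T :: "('b \<Rightarrow> complex) \<Rightarrow> 'c \<Rightarrow> complex"
    where "T f = (\<lambda>y. if y \<in> Y then f (F' y) else 0)" for f
  define T' :: "('c \<Rightarrow> complex) \<Rightarrow> 'b \<Rightarrow> complex"
    where "T' f = (\<lambda>x. if x \<in> X then f (F x) else 0)" for f
  have eq': "F' (\<psi> h y) = \<phi> h (F' y)" if "h \<in> H" "y \<in> Y" for h y
    using eq[OF that(1) F'X[OF that(2)]] F'F[of "\<phi> h (F' y)"] FF'[OF that(2)]
      X.element_image[OF subgroup.mem_carrier[OF H that(1)] F'X[OF that(2)] refl] by simp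
  have "bij_betw T {f. \<forall>x. x \<notin> X \<longrightarrow> f x = 0} {f. \<forall>y. y \<notin> Y \<longrightarrow> f y = 0}"
    by (rule bij_betw_byWitness[where f' = T']) (auto simp: T_def T'_def fun_eq_iff F'X FF' FY F'F)
  moreover have "T (\<lambda>x. if x \<in> X then f (\<phi> (inv\<^bsub>G\<^esub> h) x) else 0) =
      (\<lambda>y. if y \<in> Y then T f (\<psi> (inv\<^bsub>G\<lparr>carrier := H\<rparr>\<^esub> h) y) else 0)" if "h \<in> H" for h f
  proof -
    have "inv\<^bsub>G\<^esub> h \<in> H" using H that by (rule subgroup.m_inv_closed)
    then show ?thesis
      using Y.element_image[of "inv\<^bsub>G\<^esub> h"]
      by (auto simp: T_def fun_eq_iff G.m_inv_consistent[OF H that] F'X eq')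
  qed
  ultimately show ?thesis
    unfolding rep_isomorphic_def
    by (intro conjI rX representation_perm_rep Y exI[of _ T])
       (auto simp: restrict_rep_def perm_rep_def T_def cscale_def fun_eq_iff)
qed

lemma subgroup_stabilizer_sym_group:
  assumes "n \<ge> 1"
  shows "subgroup (stabilizer (sym_group n) (\<lambda>p. p) n) (sym_group n)"
proof (rule group.group_incl_imp_subgroup)
  show "stabilizer (sym_group n) (\<lambda>p. p) n \<subseteq> carrier (sym_group n)"
    by (auto simp: stabilizer_def)
  show "group ((sym_group n)\<lparr>carrier := stabilizer (sym_group n) (\<lambda>p. p) n\<rparr>)"
    unfolding group_stabilizer_sym_group[OF assms] by (rule sym_group_is_group)
qed (rule sym_group_is_group)

text \<open>Produces a bijection without a formula for it. It is meant for the relation of lying in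
  the same residue class, when both sets have exactly one representative per class.\<close>

lemma bij_betw_THE:
  assumes "\<And>x. x \<in> X \<Longrightarrow> \<exists>!y. y \<in> Y \<and> R x y" "\<And>y. y \<in> Y \<Longrightarrow> \<exists>!x. x \<in> X \<and> R x y"
  shows "bij_betw (\<lambda>x. THE y. y \<in> Y \<and> R x y) X Y"
proof (rule bij_betw_byWitness[where f' = "\<lambda>y. THE x. x \<in> X \<and> R x y"])
  have 1: "(THE y. y \<in> Y \<and> R x y) \<in> Y \<and> R x (THE y. y \<in> Y \<and> R x y)" if "x \<in> X" for x
    using theI'[OF assms(1)[OF that]] .
  have 2: "(THE x. x \<in> X \<and> R x y) \<in> X \<and> R (THE x. x \<in> X \<and> R x y) y" if "y \<in> Y" for y
    using theI'[OF assms(2)[OF that]] .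
  show "\<forall>x\<in>X. (THE x'. x' \<in> X \<and> R x' (THE y. y \<in> Y \<and> R x y)) = x"
    using 1 by (intro ballI the1_equality assms(2)) auto
  show "\<forall>y\<in>Y. (THE y'. y' \<in> Y \<and> R (THE x. x \<in> X \<and> R x y) y') = y"
    using 2 by (intro ballI the1_equality assms(1)) auto
qed (use theI'[OF assms(1)] theI'[OF assms(2)] in auto)


subsection \<open>Lattice points of the permutohedron\<close>

text \<open>Rado's inequalities for the permutohedron: the k smallest entries of
  \<open>delta n\<close> are 0, 0, 1, ..., k - 2, with sum (k - 1) (k - 2) / 2. All is doubled to
  avoid division. At k = 0 the formula would give 2, hence \<open>S \<noteq> {}\<close>.\<close>

definition permutohedron_points :: "nat \<Rightarrow> (nat \<Rightarrow> int) set"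
  where "permutohedron_points n =
    {x. (\<forall>i. i \<notin> {1..n} \<longrightarrow> x i = 0) \<and> 2 * sum x {1..n} = (int n - 1) * (int n - 2) \<and>
        (\<forall>S\<subseteq>{1..n}. S \<noteq> {} \<longrightarrow> (int (card S) - 1) * (int (card S) - 2) \<le> 2 * sum x S)}"

lemma permutohedron_points_sum:
  "x \<in> permutohedron_points n \<Longrightarrow> 2 * sum x {1..n} = (int n - 1) * (int n - 2)"
  by (simp add: permutohedron_points_def)

lemma permutohedron_points_ge:
  "x \<in> permutohedron_points n \<Longrightarrow> S \<subseteq> {1..n} \<Longrightarrow> S \<noteq> {} \<Longrightarrow>
    (int (card S) - 1) * (int (card S) - 2) \<le> 2 * sum x S"
  by (simp add: permutohedron_points_def)

section \<open>The polytope satisfies the subset-sum inequalities\<close>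

lemma sum_delta:
  assumes "n \<ge> 1"
  shows "2 * sum (delta n) {1..n} = (real n - 1) * (real n - 2)"
proof -
  have "sum (delta n) {1..n} = sum (delta n) {1..n - 1}"
    using assms by (intro sum.mono_neutral_right) (auto simp: delta_def)
  also have "\<dots> = (\<Sum>j<n - 1. real j)"
    by (rule sum.reindex_bij_witness[where i = "\<lambda>j. n - 1 - j" and j = "\<lambda>i. n - 1 - i"])
      (auto simp: delta_def)
  also have "2 * \<dots> = (real n - 1) * (real n - 2)"
  proof -
    have "2 * (\<Sum>j<m. real j) = real m * (real m - 1)" for m
      by (induction m) (auto simp: algebra_simps)
    from this[of "n - 1"] show ?thesis using assms by (simp add: of_nat_diff algebra_simps)
  qed
  finally show ?thesis .
qed

text \<open>Induction on the size of \<open>T\<close>, removing its least index \<open>m\<close>,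
  where \<open>delta n\<close> is largest: \<open>T\<close> fits into \<open>{m..n}\<close>, so that
  this value is at least \<open>card T - 2\<close>.\<close>

lemma sum_delta_ge:
  assumes "T \<subseteq> {1..n}" "T \<noteq> {}"
  shows "(real (card T) - 1) * (real (card T) - 2) \<le> 2 * sum (delta n) T"
proof -
  have "finite T" using assms(1) by (rule finite_subset) simp
  then show ?thesis using assms
  proof (induction "card T" arbitrary: T)
    case 0
    then show ?case by simp
  next
    case (Suc k)
    define m where "m = Min T"
    have m: "m \<in> T" using Suc by (simp add: m_def)
    have "T \<subseteq> {m..n}" using Suc by (auto simp: m_def)
    then have "card T \<le> card {m..n}" by (rule card_mono[rotated]) simp
    then have dm: "real k - 1 \<le> delta n m"
      using m Suc.prems Suc.hyps(2) by (auto simp: delta_def)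
    have s: "sum (delta n) T = delta n m + sum (delta n) (T - {m})"
      using Suc m by (simp add: sum.remove)
    show ?case
    \<comment> \<open>A singleton is treated apart: removing its element leaves the empty set, where
      the formula gives 2 although the sum is 0.\<close>
    proof (cases "k = 0")
      case True
      have "0 \<le> sum (delta n) T" by (rule sum_nonneg) (simp add: delta_def)
      then show ?thesis using True by (simp flip: Suc.hyps(2))
    next
      case False
      have c: "card (T - {m}) = k" using Suc m by simp
      then have "T - {m} \<noteq> {}" using False by (metis card.empty)
      then have "(real k - 1) * (real k - 2) \<le> 2 * sum (delta n) (T - {m})"
        using Suc.hyps(1)[of "T - {m}"] c Suc.prems by auto
      then show ?thesis using dm s unfolding Suc.hyps(2)[symmetric] by (simp add: algebra_simps)
    qed
  qed
qed

text \<open>The conditions are linear and so cut out a convex set. It contains every permuted copy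
  of \<open>delta n\<close>, because a sum of the copy over \<open>S\<close> is a sum of
  \<open>delta n\<close> over an image of the same size.\<close>

lemma delta_polytope_bounds:
  assumes n: "n \<ge> 1" and x: "x \<in> delta_polytope n"
  shows "\<And>i. i \<notin> {1..n} \<Longrightarrow> x i = 0"
    and "2 * sum x {1..n} = (real n - 1) * (real n - 2)"
    and "\<And>S. S \<subseteq> {1..n} \<Longrightarrow> S \<noteq> {} \<Longrightarrow> (real (card S) - 1) * (real (card S) - 2) \<le> 2 * sum x S"
proof -
  let ?B = "{x :: nat \<Rightarrow> real. (\<forall>i. i \<notin> {1..n} \<longrightarrow> x i = 0) \<and>
      2 * sum x {1..n} = (real n - 1) * (real n - 2) \<and>
      (\<forall>S\<subseteq>{1..n}. S \<noteq> {} \<longrightarrow> (real (card S) - 1) * (real (card S) - 2) \<le> 2 * sum x S)}"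
  have "convex ?B"
  proof (rule convexI)
    fix x y :: "nat \<Rightarrow> real" and u v :: real
    assume xy: "x \<in> ?B" "y \<in> ?B" and uv: "0 \<le> u" "0 \<le> v" "u + v = 1"
    have s: "2 * sum (u *\<^sub>R x + v *\<^sub>R y) S = u * (2 * sum x S) + v * (2 * sum y S)" for S
      by (simp add: sum.distrib flip: sum_distrib_left)
    have comb: "u * c + v * c = c" for c using uv by (metis mult_1 distrib_right)
    have "c \<le> u * a + v * b" if "c \<le> a" "c \<le> b" for a b c
      using mult_left_mono[OF that(1) uv(1)] mult_left_mono[OF that(2) uv(2)] comb[of c] by linarith
    then show "u *\<^sub>R x + v *\<^sub>R y \<in> ?B"
      using xy unfolding mem_Collect_eq s by (auto simp: comb)
  qed
  moreover have "delta n \<circ> p \<in> ?B" if p: "p permutes {1..n}" for p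
  proof -
    have s: "sum (delta n \<circ> p) S = sum (delta n) (p ` S)" for S
      using sum.reindex[of p S "delta n"] permutes_inj_on[OF p] by simp
    have "card (p ` S) = card S" for S using permutes_inj_on[OF p] by (rule card_image)
    moreover have "p ` S \<subseteq> {1..n}" if "S \<subseteq> {1..n}" for S using that permutes_image[OF p] by blast
    moreover have zero: "(delta n \<circ> p) i = 0" if "i \<notin> {1..n}" for i
      using that permutes_not_in[OF p that] by (auto simp: delta_def)
    ultimately have "(real (card S) - 1) * (real (card S) - 2) \<le> 2 * sum (delta n \<circ> p) S"
      if "S \<subseteq> {1..n}" "S \<noteq> {}" for S
      using sum_delta_ge[of "p ` S" n] that unfolding s by simp
    then show ?thesis
      using sum_delta[OF n] zero unfolding mem_Collect_eq s permutes_image[OF p] by blast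
  qed
  ultimately have "delta_polytope n \<subseteq> ?B"
    unfolding delta_polytope_eq by (intro hull_minimal) blast+
  with x have B: "x \<in> ?B" by blast
  from B show "\<And>i. i \<notin> {1..n} \<Longrightarrow> x i = 0" by blast
  from B show "2 * sum x {1..n} = (real n - 1) * (real n - 2)" by blast
  from B show "\<And>S. S \<subseteq> {1..n} \<Longrightarrow> S \<noteq> {} \<Longrightarrow>
    (real (card S) - 1) * (real (card S) - 2) \<le> 2 * sum x S" by blast
qed

text \<open>The lower bound is the inequality for a singleton. The upper bound comes from the
  complement of a singleton, whose doubled bound lies 2 (n - 2) below the doubled total.\<close>

lemma permutohedron_points_le:
  assumes n: "n \<ge> 2" and x: "x \<in> permutohedron_points n" and i: "i \<in> {1..n}"
  shows "0 \<le> x i" "x i \<le> int n - 2"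
proof -
  have "(int (card {i}) - 1) * (int (card {i}) - 2) \<le> 2 * sum x {i}"
    by (rule permutohedron_points_ge[OF x]) (use i in auto)
  then show "0 \<le> x i" by simp
  let ?S = "{1..n} - {i}"
  have c: "int (card ?S) = int n - 1" using i n by simp
  then have "card ?S \<noteq> 0" using n by linarith
  then have "?S \<noteq> {}" by (metis card.empty)
  then have "(int n - 1 - 1) * (int n - 1 - 2) \<le> 2 * sum x ?S"
    using permutohedron_points_ge[OF x, of ?S] unfolding c by blast
  moreover have "2 * (x i + sum x ?S) = (int n - 1) * (int n - 2)"
    using permutohedron_points_sum[OF x] i by (simp add: sum.remove)
  moreover have "x i \<le> m - 2" if "(m - 1 - 1) * (m - 1 - 2) \<le> 2 * s"
    "2 * (x i + s) = (m - 1) * (m - 2)" for m s :: int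
    using that by (simp add: algebra_simps)
  ultimately show "x i \<le> int n - 2" by blast
qed

section \<open>Integer points satisfying the inequalities lie in the polytope\<close>

lemma sum_fun_upd2:
  fixes x :: "nat \<Rightarrow> int"
  assumes "finite S" "i \<noteq> j"
  shows "sum (x(i := x i + 1, j := x j - 1)) S
    = sum x S + (if i \<in> S then 1 else 0) - (if j \<in> S then 1 else 0)"
proof -
  have "x(i := x i + 1, j := x j - 1)
    = (\<lambda>l. x l + (if l = i then 1 else 0) - (if l = j then 1 else 0))"
    using assms(2) by auto
  then show ?thesis using assms(1) by (simp add: sum.distrib sum_subtractf)
qed

text \<open>If \<open>S\<close> contains \<open>j\<close> but not \<open>i\<close>, then \<open>S - {j}\<close> and \<open>S \<union> {i}\<close> show that \<open>S\<close> is not tight,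
  because \<open>(k - 1) (k - 2)\<close> is strictly convex in \<open>k\<close>.\<close>

lemma permutohedron_points_transfer:
  assumes x: "x \<in> permutohedron_points n" and ij: "i \<in> {1..n}" "j \<in> {1..n}" "i \<noteq> j"
    and eq: "x i = x j" and pos: "x j > 0"
  shows "x(i := x i + 1, j := x j - 1) \<in> permutohedron_points n"
proof -
  let ?y = "x(i := x i + 1, j := x j - 1)"
  have ineq: "(int (card S) - 1) * (int (card S) - 2) \<le> 2 * sum x S"
    if "S \<subseteq> {1..n}" "S \<noteq> {}" for S
    using x that by (rule permutohedron_points_ge)
  have "(int (card S) - 1) * (int (card S) - 2) \<le> 2 * sum ?y S"
    if S: "S \<subseteq> {1..n}" "S \<noteq> {}" for S
  proof -
    have fin: "finite S" using S(1) by (rule finite_subset) simp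
    define k where "k = int (card S)"
    have "(k - 1) * (k - 2) + 2 \<le> 2 * sum x S" if jS: "j \<in> S" "i \<notin> S"
    proof -
      have lt: "(k - 1) * (k - 2) < 2 * sum x S"
      \<comment> \<open>For \<open>S = {j}\<close> the set \<open>S - {j}\<close> is empty and has
        no inequality; positivity of \<open>x j\<close> takes its place.\<close>
      proof (cases "S = {j}")
        case True
        then show ?thesis using pos by (simp add: k_def)
      next
        case False
        have k: "int (card (S - {j})) = k - 1" "int (card (insert i S)) = k + 1"
          using jS fin card_gt_0_iff[of S] S by (auto simp: k_def)
        have "S - {j} \<noteq> {}" using False jS by auto
        then have "(k - 2) * (k - 3) \<le> 2 * sum x (S - {j})"
          using ineq[of "S - {j}"] S k by auto
        moreover have "k * (k - 1) \<le> 2 * sum x (insert i S)"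
          using ineq[of "insert i S"] S ij k by auto
        moreover have "sum x (S - {j}) = sum x S - x j" using fin jS by (simp add: sum_diff1)
        moreover have "sum x (insert i S) = sum x S + x i" using fin jS by simp
        \<comment> \<open>As \<open>x i = x j\<close>, the two sums add up to
          \<open>2 * sum x S\<close>, while (k - 2) (k - 3) + k (k - 1) exceeds 2 (k - 1) (k - 2) by
          2.\<close>
        ultimately show ?thesis using eq by (simp add: algebra_simps)
      qed
      \<comment> \<open>Both sides of \<open>lt\<close> are even, so they differ by at least 2; this
        pays for the unit that \<open>S\<close> loses at \<open>j\<close>.\<close>
      have "even ((k - 1) * (k - 2))" by simp
      then obtain m where "(k - 1) * (k - 2) = 2 * m" ..
      with lt show ?thesis by presburger
    qed
    then show ?thesis
      using ineq[OF S] unfolding sum_fun_upd2[OF fin ij(3)] k_def by (auto split: if_splits)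
  qed
  moreover have "sum ?y {1..n} = sum x {1..n}"
    using ij sum_fun_upd2[of "{1..n}" i j x] by simp
  ultimately show ?thesis
    using x ij unfolding permutohedron_points_def by auto
qed

text \<open>Three zeros would violate the inequality for the set of zeros, and the positive entries
  are distinct numbers between 1 and n - 2. Since there are n entries, both counts are extremal and
  \<open>x\<close> rearranges \<open>delta n\<close>.\<close>

lemma permutohedron_points_vertex:
  assumes n: "n \<ge> 2" and x: "x \<in> permutohedron_points n"
    and inj: "\<And>i j. i \<in> {1..n} \<Longrightarrow> j \<in> {1..n} \<Longrightarrow> i \<noteq> j \<Longrightarrow> x i = x j \<Longrightarrow> x j \<le> 0"
  obtains p where "p permutes {1..n}" "(\<lambda>i. real_of_int (x i)) = delta n \<circ> p"
proof -
  define P where "P = {i \<in> {1..n}. x i > 0}"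
  define Z where "Z = {i \<in> {1..n}. x i = 0}"
  have PZ: "P \<union> Z = {1..n}" "P \<inter> Z = {}" and [simp]: "finite P" "finite Z"
    using permutohedron_points_le(1)[OF n x] by (force simp: P_def Z_def)+
  have "card P + card Z = n" using card_Un_disjoint[of P Z] PZ by simp
  have "card Z \<le> 2"
  proof (rule ccontr)
    assume Z: "\<not> card Z \<le> 2"
    then have "Z \<noteq> {}" "Z \<subseteq> {1..n}" by (force, auto simp: Z_def)
    then have "(int (card Z) - 1) * (int (card Z) - 2) \<le> 2 * sum x Z"
      by (intro permutohedron_points_ge[OF x])
    moreover have "sum x Z = 0" by (simp add: Z_def)
    moreover have "0 < (int (card Z) - 1) * (int (card Z) - 2)" using Z by simp
    ultimately show False by simp
  qed
  \<comment> \<open>The position at which \<open>delta n\<close> takes the value \<open>x i\<close>,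
    for positive entries; the two zeros are sent to n - 1 and n by \<open>g\<close>.\<close>
  define f where "f i = n - 1 - nat (x i)" for i
  have bd: "0 \<le> x i" "x i \<le> int n - 2" if "i \<in> {1..n}" for i
    using permutohedron_points_le[OF n x that] by auto
  have injf: "inj_on f P"
  proof (rule inj_onI)
    fix i j assume "i \<in> P" "j \<in> P" "f i = f j"
    then show "i = j" using inj[of i j] bd[of i] bd[of j] by (force simp: f_def P_def)
  qed
  have fP: "f ` P \<subseteq> {1..n - 2}" using bd by (force simp: f_def P_def)
  then have "card P \<le> n - 2" using injf card_mono[OF _ fP] by (simp add: card_image)
  then have cP: "card P = n - 2" and cZ: "card Z = 2"
    using \<open>card P + card Z = n\<close> \<open>card Z \<le> 2\<close> n by auto
  have "f ` P = {1..n - 2}" by (rule card_subset_eq) (use fP injf cP in \<open>auto simp: card_image\<close>)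
  then have bf: "bij_betw f P {1..n - 2}" using injf by (simp add: bij_betw_def)
  have "card Z = card {n - 1, n}" using cZ n by (cases n) auto
  then obtain g where bg: "bij_betw g Z {n - 1, n}"
    using finite_same_card_bij[of Z "{n - 1, n}"] by auto
  define p where "p i = (if i \<in> P then f i else if i \<in> Z then g i else i)" for i
  have "bij_betw p P {1..n - 2}" using bf by (rule bij_betw_cong[THEN iffD1, rotated]) (simp add: p_def)
  moreover have "bij_betw p Z {n - 1, n}"
    using bg by (rule bij_betw_cong[THEN iffD1, rotated]) (use PZ in \<open>auto simp: p_def\<close>)
  ultimately have "bij_betw p (P \<union> Z) ({1..n - 2} \<union> {n - 1, n})"
    using n by (intro bij_betw_combine) auto
  moreover have "{1..n - 2} \<union> {n - 1, n} = {1..n}" using n by auto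
  ultimately have p: "p permutes {1..n}"
    using PZ by (intro bij_imp_permutes) (auto simp: p_def)
  have "real_of_int (x i) = delta n (p i)" for i
  proof -
    consider "i \<in> P" | "i \<in> Z" | "i \<notin> {1..n}" using PZ by blast
    then show ?thesis
    proof cases
      case 1
      then show ?thesis using bd[of i] fP by (auto simp: p_def f_def delta_def P_def of_nat_diff)
    next
      case 2
      then have "p i \<in> {n - 1, n}" using bg PZ by (auto simp: p_def bij_betw_def)
      then show ?thesis using 2 by (auto simp: delta_def Z_def)
    next
      case 3
      then show ?thesis
        using x permutes_not_in[OF p 3] by (auto simp: permutohedron_points_def delta_def)
    qed
  qed
  then show thesis using that[OF p] by (simp add: comp_def)
qed

text \<open>A point with a repeated positive entry is the midpoint of two points with larger sum of
  squares, and a point without one is a vertex.\<close>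

lemma permutohedron_points_in_delta_polytope:
  assumes n: "n \<ge> 2" and "x \<in> permutohedron_points n"
  shows "(\<lambda>i. real_of_int (x i)) \<in> delta_polytope n"
  using assms(2)
\<comment> \<open>The entries lie between 0 and n - 2, so the sum of squares stays below this cubic
  bound. Each transfer raises it by 2, so the measure drops.\<close>
proof (induction "nat (int n * (int n)\<^sup>2 - (\<Sum>i\<in>{1..n}. (x i)\<^sup>2))" arbitrary: x rule: less_induct)
  case less
  show ?case
  proof (cases "\<exists>i\<in>{1..n}. \<exists>j\<in>{1..n}. i \<noteq> j \<and> x i = x j \<and> x j > 0")
    case True
    then obtain i j where ij: "i \<in> {1..n}" "j \<in> {1..n}" "i \<noteq> j" "x i = x j" "x j > 0" by blast
    define t where "t i j = x(i := x i + 1, j := x j - 1)" for i j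
    have le: "(\<Sum>i\<in>{1..n}. (y i)\<^sup>2) \<le> int n * (int n)\<^sup>2" if y: "y \<in> permutohedron_points n" for y
    proof -
      have "(\<Sum>i\<in>{1..n}. (y i)\<^sup>2) \<le> int (card {1..n}) * (int n)\<^sup>2"
        by (rule sum_bounded_above)
          (use permutohedron_points_le[OF n y] in \<open>fastforce intro: power_mono\<close>)
      then show ?thesis by simp
    qed
    \<comment> \<open>For equal entries v the transfer gives (v + 1)^2 + (v - 1)^2 = 2 v^2 +
      2.\<close>
    have sq: "(\<Sum>i\<in>{1..n}. (t i' j' i)\<^sup>2) = (\<Sum>i\<in>{1..n}. (x i)\<^sup>2) + 2"
      if "i' \<in> {1..n}" "j' \<in> {1..n}" "i' \<noteq> j'" "x i' = x j'" for i' j'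
    proof -
      have "(\<Sum>i\<in>{1..n}. (t i' j' i)\<^sup>2) = (\<Sum>i\<in>{1..n}. (x i)\<^sup>2 +
          ((if i = i' then 2 * x i' + 1 else 0) + (if i = j' then 1 - 2 * x j' else 0)))"
        using that by (intro sum.cong) (auto simp: t_def power2_eq_square algebra_simps)
      also have "\<dots> = (\<Sum>i\<in>{1..n}. (x i)\<^sup>2) + 2"
        using that by (simp add: sum.distrib del: One_nat_def)
      finally show ?thesis .
    qed
    have "(\<lambda>l. real_of_int (t i' j' l)) \<in> delta_polytope n"
      if "i' \<in> {1..n}" "j' \<in> {1..n}" "i' \<noteq> j'" "x i' = x j'" "x j' > 0" for i' j'
    proof -
      have t: "t i' j' \<in> permutohedron_points n"
        unfolding t_def using less.prems that by (rule permutohedron_points_transfer)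
      show ?thesis
        using le[OF t] sq[OF that(1-4)] by (intro less.hyps t) linarith
    qed
    then have "(\<lambda>l. real_of_int (t i j l)) \<in> delta_polytope n"
      "(\<lambda>l. real_of_int (t j i l)) \<in> delta_polytope n" using ij by auto
    then have "(1/2) *\<^sub>R (\<lambda>l. real_of_int (t i j l)) + (1/2) *\<^sub>R (\<lambda>l. real_of_int (t j i l))
        \<in> delta_polytope n"
      unfolding delta_polytope_def by (intro convexD[OF convex_convex_hull]) auto
    moreover have "(1/2) *\<^sub>R (\<lambda>l. real_of_int (t i j l)) + (1/2) *\<^sub>R (\<lambda>l. real_of_int (t j i l))
        = (\<lambda>l. real_of_int (x l))"
      using ij by (auto simp: t_def fun_eq_iff field_simps)
    ultimately show ?thesis by simp
  next
    case False
    then obtain p where "p permutes {1..n}" "(\<lambda>i. real_of_int (x i)) = delta n \<circ> p"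
      using permutohedron_points_vertex[OF n less.prems] by (metis not_less)
    then show ?thesis unfolding delta_polytope_eq by (auto intro: hull_inc)
  qed
qed

text \<open>From here on, membership in a convex hull is replaced by inequalities between
  integers.\<close>

lemma Lat_delta_polytope:
  assumes n: "n \<ge> 2"
  shows "Lat (delta_polytope n) = (\<lambda>x i. real_of_int (x i)) ` permutohedron_points n"
proof (intro equalityI subsetI)
  fix y assume "y \<in> Lat (delta_polytope n)"
  then have y: "y \<in> delta_polytope n" and "\<And>i. y i \<in> \<int>" by (auto simp: Lat_def)
  then have yx: "y = (\<lambda>i. real_of_int \<lfloor>y i\<rfloor>)" by (auto simp: fun_eq_iff)
  define x where "x = (\<lambda>i. \<lfloor>y i\<rfloor>)"
  have yx: "y = (\<lambda>i. real_of_int (x i))" using yx unfolding x_def .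
  have n1: "n \<ge> 1" using n by simp
  note b = delta_polytope_bounds[OF n1 y, unfolded yx]
  have "x i = 0" if "i \<notin> {1..n}" for i using b(1)[OF that] by simp
  moreover have "2 * sum x {1..n} = (int n - 1) * (int n - 2)"
  proof -
    have "real_of_int (2 * sum x {1..n}) = real_of_int ((int n - 1) * (int n - 2))"
      using b(2) by simp
    then show ?thesis by (simp only: of_int_eq_iff)
  qed
  moreover have "(int (card S) - 1) * (int (card S) - 2) \<le> 2 * sum x S"
    if "S \<subseteq> {1..n}" "S \<noteq> {}" for S
  proof -
    have "real_of_int ((int (card S) - 1) * (int (card S) - 2)) \<le> real_of_int (2 * sum x S)"
      using b(3)[OF that] by simp
    then show ?thesis by (simp only: of_int_le_iff)
  qed
  ultimately have "x \<in> permutohedron_points n" unfolding permutohedron_points_def by blast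
  then show "y \<in> (\<lambda>x i. real_of_int (x i)) ` permutohedron_points n" using yx by blast
next
  fix y assume "y \<in> (\<lambda>x i. real_of_int (x i)) ` permutohedron_points n"
  then show "y \<in> Lat (delta_polytope n)"
    using permutohedron_points_in_delta_polytope[OF n] by (auto simp: Lat_def)
qed


subsection \<open>Residue classes modulo the diagonal\<close>

text \<open>Equality in (Z/n)^(n-1) modulo the diagonal. Coordinate n is left out so that one
  relation compares lattice points with parking functions of length n - 1.\<close>

definition shift_cong :: "nat \<Rightarrow> (nat \<Rightarrow> int) \<Rightarrow> (nat \<Rightarrow> int) \<Rightarrow> bool"
  where "shift_cong n x y \<longleftrightarrow> (\<exists>t. \<forall>i\<in>{1..n - 1}. [x i = y i + t] (mod int n))"

lemma shift_cong_sym: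
  assumes "shift_cong n x y"
  shows "shift_cong n y x"
proof -
  obtain t where "\<And>i. i \<in> {1..n - 1} \<Longrightarrow> [x i = y i + t] (mod int n)"
    using assms unfolding shift_cong_def by blast
  then have "[y i = x i + - t] (mod int n)" if "i \<in> {1..n - 1}" for i
    using cong_sym[OF cong_diff[OF _ cong_refl[of t], of "x i" "y i + t"]] that by simp
  then show ?thesis unfolding shift_cong_def by blast
qed

lemma shift_cong_trans:
  assumes "shift_cong n x y" "shift_cong n y z"
  shows "shift_cong n x z"
proof -
  obtain s where s: "\<And>i. i \<in> {1..n - 1} \<Longrightarrow> [x i = y i + s] (mod int n)"
    using assms unfolding shift_cong_def by blast
  obtain t where t: "\<And>i. i \<in> {1..n - 1} \<Longrightarrow> [y i = z i + t] (mod int n)"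
    using assms unfolding shift_cong_def by blast
  have "[x i = z i + (t + s)] (mod int n)" if "i \<in> {1..n - 1}" for i
    using cong_trans[OF s cong_add[OF t cong_refl]] that by (simp add: add.assoc)
  then show ?thesis unfolding shift_cong_def by blast
qed

lemma shift_cong_permute:
  assumes "p permutes {1..n - 1}" "shift_cong n x y"
  shows "shift_cong n (x \<circ> p) (y \<circ> p)"
  using assms(2) permutes_in_image[OF assms(1)] unfolding shift_cong_def comp_def by blast

text \<open>The coordinates of a sum-zero vector that are congruent to \<open>t\<close> determine the last one:
  it is congruent to \<open>- (n - 1) t\<close>, hence to \<open>t\<close>.\<close>

lemma shift_cong_last:
  assumes n: "n \<ge> 1" and xy: "shift_cong n x y" and eq: "sum x {1..n} = sum y {1..n}"
  obtains t where "\<And>i. i \<in> {1..n} \<Longrightarrow> [x i = y i + t] (mod int n)"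
proof -
  obtain t where t: "\<And>i. i \<in> {1..n - 1} \<Longrightarrow> [x i = y i + t] (mod int n)"
    using xy unfolding shift_cong_def by blast
  have ins: "{1..n} = insert n {1..n - 1}" using n by auto
  have sums: "sum z {1..n} = z n + sum z {1..n - 1}" for z :: "nat \<Rightarrow> int"
    unfolding ins using n by (subst sum.insert) auto
  have "[sum x {1..n - 1} = (\<Sum>i\<in>{1..n - 1}. y i + t)] (mod int n)"
    by (rule cong_sum) (rule t)
  moreover have "(\<Sum>i\<in>{1..n - 1}. y i + t) = sum y {1..n - 1} + (int n - 1) * t"
    using n by (simp add: sum.distrib of_nat_diff)
  ultimately have "int n dvd sum x {1..n - 1} - (sum y {1..n - 1} + (int n - 1) * t)"
    by (simp add: cong_iff_dvd_diff)
  \<comment> \<open>With equal totals the negated difference of the partial sums is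
    \<open>x n - y n\<close>, and (n - 1) t - n t = - t.\<close>
  then have "int n dvd - (sum x {1..n - 1} - (sum y {1..n - 1} + (int n - 1) * t)) - int n * t"
    by (intro dvd_diff) (simp_all only: dvd_minus_iff dvd_triv_left)
  moreover have "- (sum x {1..n - 1} - (sum y {1..n - 1} + (int n - 1) * t)) - int n * t
      = x n - (y n + t)"
    using eq unfolding sums by (simp add: algebra_simps)
  ultimately have "[x n = y n + t] (mod int n)" by (simp add: cong_iff_dvd_diff)
  then show thesis using t by (intro that[of t]) (metis ins insertE)
qed

text \<open>Take a vector of least sum of squares among those in the class with the right coordinate
  sum. Comparing it with its shift by n times the indicator of \<open>S\<close> minus the constant
  \<open>card S\<close> gives the inequality for \<open>S\<close>.\<close>

lemma permutohedron_points_shift_cong_exists: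
  assumes n: "n \<ge> 2"
  shows "\<exists>x\<in>permutohedron_points n. shift_cong n x b"
proof -
  define c where "c = (int n - 1) * (int n - 2) div 2"
  have c: "2 * c = (int n - 1) * (int n - 2)" by (simp add: c_def)
  \<comment> \<open>Extends \<open>b\<close> by the last coordinate that makes the total
    \<open>c\<close>, so that some vector satisfies \<open>A\<close>.\<close>
  define b' where "b' i = (if i \<in> {1..n - 1} then b i
    else if i = n then c - sum b {1..n - 1} else 0)" for i
  define A where "A x \<longleftrightarrow> (\<forall>i. i \<notin> {1..n} \<longrightarrow> x i = 0) \<and> sum x {1..n} = c \<and>
    (\<exists>t. \<forall>i\<in>{1..n}. [x i = b' i + t] (mod int n))" for x
  have "{1..n} = insert n {1..n - 1}" using n by auto
  then have "sum b' {1..n} = b' n + sum b' {1..n - 1}" using n by simp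
  also have "sum b' {1..n - 1} = sum b {1..n - 1}" by (rule sum.cong) (auto simp: b'_def)
  also have "b' n = c - sum b {1..n - 1}" using n by (auto simp: b'_def)
  finally have "sum b' {1..n} = c" by simp
  then have "A b'" using n unfolding A_def by (auto simp: b'_def intro!: exI[of _ 0])
  then obtain x where Ax: "A x"
    and min: "\<And>y. A y \<Longrightarrow> nat (\<Sum>i\<in>{1..n}. (x i)\<^sup>2) \<le> nat (\<Sum>i\<in>{1..n}. (y i)\<^sup>2)"
    using ex_has_least_nat[of A b' "\<lambda>x. nat (\<Sum>i\<in>{1..n}. (x i)\<^sup>2)"] by blast
  from Ax obtain t where t: "\<And>i. i \<in> {1..n} \<Longrightarrow> [x i = b' i + t] (mod int n)"
    and x0: "\<And>i. i \<notin> {1..n} \<Longrightarrow> x i = 0" and xc: "sum x {1..n} = c"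
    unfolding A_def by blast
  have "(int (card S) - 1) * (int (card S) - 2) \<le> 2 * sum x S" if S: "S \<subseteq> {1..n}" "S \<noteq> {}" for S
  proof -
    define k where "k = int (card S)"
    have fin: "finite S" using S(1) by (rule finite_subset) simp
    have k: "k \<ge> 1" using S fin by (simp add: k_def Suc_le_eq card_gt_0_iff)
    define e where "e i = (if i \<in> S then 1 else 0 :: int)" for i
    have e: "(\<Sum>i\<in>{1..n}. f i * e i) = sum f S" for f
      using S by (simp add: e_def if_distrib sum.If_cases Int_absorb1 cong: if_cong)
    \<comment> \<open>Adding n on the k elements of \<open>S\<close> and subtracting k everywhere
      keeps the total; modulo n it is a diagonal shift by - k.\<close>
    define y where "y i = (if i \<in> {1..n} then x i + (int n * e i - k) else 0)" for i
    have "sum y {1..n} = (\<Sum>i\<in>{1..n}. x i + int n * e i - k)"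
      by (rule sum.cong) (auto simp: y_def)
    also have "\<dots> = c"
      using e[of "\<lambda>_. int n"] xc by (simp add: sum.distrib sum_subtractf k_def)
    finally have "sum y {1..n} = c" .
    moreover have "[y i = b' i + (t - k)] (mod int n)" if "i \<in> {1..n}" for i
    proof -
      have "y i - (b' i + (t - k)) = (x i - (b' i + t)) + int n * e i"
        using that by (simp add: y_def)
      moreover have "int n dvd (x i - (b' i + t)) + int n * e i"
        using t[OF that] unfolding cong_iff_dvd_diff by (intro dvd_add dvd_triv_left)
      ultimately show ?thesis unfolding cong_iff_dvd_diff by (simp only:)
    qed
    moreover have "y i = 0" if "i \<notin> {1..n}" for i using that unfolding y_def by (rule if_not_P)
    ultimately have "A y" unfolding A_def by blast
    then have "nat (\<Sum>i\<in>{1..n}. (x i)\<^sup>2) \<le> nat (\<Sum>i\<in>{1..n}. (y i)\<^sup>2)" by (rule min)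
    moreover have "0 \<le> (\<Sum>i\<in>{1..n}. (y i)\<^sup>2)" by (rule sum_nonneg) simp
    ultimately have "(\<Sum>i\<in>{1..n}. (x i)\<^sup>2) \<le> (\<Sum>i\<in>{1..n}. (y i)\<^sup>2)" by linarith
    also have "(\<Sum>i\<in>{1..n}. (y i)\<^sup>2) = (\<Sum>i\<in>{1..n}. (x i)\<^sup>2 +
        (2 * int n * x i + (int n)\<^sup>2 - 2 * k * int n) * e i - 2 * k * x i + k\<^sup>2)"
      by (rule sum.cong) (auto simp: y_def e_def power2_eq_square algebra_simps)
    also have "\<dots> = (\<Sum>i\<in>{1..n}. (x i)\<^sup>2) + (\<Sum>i\<in>S. 2 * int n * x i + (int n)\<^sup>2 - 2 * k * int n)
        - 2 * k * c + int n * k\<^sup>2"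
      unfolding xc[symmetric] sum.distrib sum_subtractf e sum_distrib_left[symmetric] by simp
    also have "(\<Sum>i\<in>S. 2 * int n * x i + (int n)\<^sup>2 - 2 * k * int n)
        = 2 * int n * sum x S + k * ((int n)\<^sup>2 - 2 * k * int n)"
      unfolding sum.distrib sum_subtractf sum_distrib_left[symmetric]
      by (simp add: k_def algebra_simps)
    finally have "0 \<le> 2 * int n * sum x S + k * ((int n)\<^sup>2 - 2 * k * int n)
        - k * (2 * c) + int n * k\<^sup>2" by simp
    \<comment> \<open>Since 2 c = n^2 - 3 n + 2, the previous right-hand side is this product minus
      2 k, and k is positive.\<close>
    then have "0 < int n * (2 * sum x S - k * k + 3 * k)"
      unfolding c using k by (simp add: algebra_simps power2_eq_square)
    then have "0 < 2 * sum x S - k * k + 3 * k" using n by (simp add: zero_less_mult_iff)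
    moreover obtain m where "k * k - 3 * k = 2 * m"
    proof -
      have "even (k * k - 3 * k)" by simp
      then show thesis using that by blast
    qed
    \<comment> \<open>By parity the strict inequality gains 2, which gives exactly (k - 1) (k -
      2).\<close>
    ultimately have "k * k - 3 * k + 2 \<le> 2 * sum x S" by presburger
    then show ?thesis by (simp add: k_def algebra_simps)
  qed
  then have "x \<in> permutohedron_points n"
    using x0 xc c unfolding permutohedron_points_def by blast
  moreover have "shift_cong n x b"
    unfolding shift_cong_def
  proof (intro exI ballI)
    fix i assume "i \<in> {1..n - 1}"
    then show "[x i = b i + t] (mod int n)" using t[of i] by (auto simp: b'_def)
  qed
  ultimately show ?thesis by blast
qed

text \<open>Let \<open>S\<close> be the set of the coordinates where \<open>y - x\<close> takes its maximum \<open>M\<close>. Elsewhere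
  \<open>y - x\<close> is at most \<open>M - n\<close>, so that \<open>n - |S| \<le> M\<close>, and then the bound for \<open>x\<close> on \<open>S\<close>
  contradicts that for \<open>y\<close> on the complement of \<open>S\<close>.\<close>

lemma permutohedron_points_shift_cong_unique:
  assumes n: "n \<ge> 2" and x: "x \<in> permutohedron_points n" and y: "y \<in> permutohedron_points n"
    and xy: "shift_cong n x y"
  shows "x = y"
proof -
  have sum_x: "2 * sum x {1..n} = (int n - 1) * (int n - 2)"
    and sum_y: "2 * sum y {1..n} = (int n - 1) * (int n - 2)"
    using x y by (simp_all only: permutohedron_points_sum)
  obtain t where "\<And>i. i \<in> {1..n} \<Longrightarrow> [x i = y i + t] (mod int n)"
    using shift_cong_last[OF _ xy] sum_x sum_y n
    by (metis mult_cancel_left one_le_numeral order_trans zero_neq_numeral)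
  then have t: "int n dvd x i - (y i + t)" if "i \<in> {1..n}" for i
    using that by (simp add: cong_iff_dvd_diff)
  define d where "d i = y i - x i" for i
  define M where "M = Max (d ` {1..n})"
  define S where "S = {i \<in> {1..n}. d i = M}"
  have "M \<in> d ` {1..n}" unfolding M_def using n by (intro Max_in) auto
  then have S: "S \<noteq> {}" "S \<subseteq> {1..n}" "finite S" by (auto simp: S_def)
  define k where "k = int (card S)"
  have k: "k \<ge> 1" using S by (simp add: k_def Suc_le_eq card_gt_0_iff)
  let ?C = "{1..n} - S"
  have cC: "int (card ?C) = int n - k"
    using S card_mono[of "{1..n}" S] by (simp add: card_Diff_subset k_def of_nat_diff)
  have split: "sum z {1..n} = sum z S + sum z ?C" for z :: "nat \<Rightarrow> int"
    using S by (simp add: sum.subset_diff)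
  have d0: "sum d {1..n} = 0" using sum_x sum_y by (simp add: d_def sum_subtractf)
  have dS: "sum d S = k * M" using S by (simp add: S_def k_def)
  have dC: "d i \<le> M - int n" if i: "i \<in> ?C" for i
  proof -
    obtain m where m: "m \<in> S" using S by blast
    have "int n dvd (x i - (y i + t)) - (x m - (y m + t))"
      using i m S by (intro dvd_diff t) auto
    also have "(x i - (y i + t)) - (x m - (y m + t)) = M - d i" using m by (simp add: S_def d_def)
    finally have "int n dvd M - d i" .
    moreover have "d i \<le> M" using i by (simp add: M_def)
    moreover have "d i \<noteq> M" using i by (auto simp: S_def)
    ultimately have "int n \<le> M - d i" by (intro zdvd_imp_le) auto
    then show ?thesis by simp
  qed
  have "?C = {}"
  proof (rule ccontr)
    assume C: "?C \<noteq> {}"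
    have "sum d ?C \<le> (int n - k) * (M - int n)"
      using sum_bounded_above[of ?C d "M - int n"] dC unfolding cC by blast
    then have "0 \<le> k * M + (int n - k) * (M - int n)" using d0 split[of d] dS by simp
    \<comment> \<open>The terms in \<open>M\<close> add up to n M, and the rest is - n (n -
      k).\<close>
    then have "0 \<le> int n * (M - (int n - k))" by (simp add: algebra_simps)
    then have "int n - k \<le> M" using n by (simp add: zero_le_mult_iff)
    then have "k * (int n - k) \<le> sum d S" using k unfolding dS by (intro mult_left_mono) auto
    moreover have "(k - 1) * (k - 2) \<le> 2 * sum x S"
      unfolding k_def using x S(2,1) by (rule permutohedron_points_ge)
    moreover have "(int (card ?C) - 1) * (int (card ?C) - 2) \<le> 2 * sum y ?C"
      using y C by (intro permutohedron_points_ge) auto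
    moreover have "sum d S = sum y S - sum x S" by (simp add: d_def sum_subtractf)
    \<comment> \<open>The estimates give 2 k (n - k) + (k - 1) (k - 2) + (n - k - 1) (n - k - 2) as
      a lower bound for twice the total of \<open>y\<close>. This equals (n - 1) (n - 2) + 2, which
      is too large.\<close>
    ultimately show False
      using sum_y unfolding cC split[of y] by (simp add: algebra_simps)
  qed
  then have SU: "S = {1..n}" using S by blast
  \<comment> \<open>Now \<open>d\<close> is constant with sum 0.\<close>
  then have "int n * M = 0" using dS d0 by (simp add: k_def)
  then have "M = 0" using n by simp
  then have "x i = y i" if "i \<in> {1..n}" for i
    using that unfolding SU[symmetric] by (simp add: S_def d_def)
  moreover have "x i = y i" if "i \<notin> {1..n}" for i
    using x y that by (simp add: permutohedron_points_def del: atLeastAtMost_iff)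
  ultimately show ?thesis by blast
qed


subsection \<open>Parking functions\<close>

text \<open>In a sorted list the entries that are at most \<open>v\<close> form an initial segment,
  whose length is their number.\<close>

lemma sorted_nth_le_iff:
  assumes "sorted xs" "i < length xs"
  shows "xs ! i \<le> v \<longleftrightarrow> i < length (filter (\<lambda>x. x \<le> v) xs)"
proof -
  let ?J = "{j. j < length xs \<and> xs ! j \<le> v}"
  have "i < card ?J" if "xs ! i \<le> v"
  proof -
    have "{..i} \<subseteq> ?J" using that assms by (auto intro: order_trans[OF sorted_nth_mono])
    then have "card {..i} \<le> card ?J" by (intro card_mono) auto
    then show ?thesis by simp
  qed
  moreover have "card ?J \<le> i" if "\<not> xs ! i \<le> v"
  proof -
    have "?J \<subseteq> {..<i}"
      using that sorted_nth_mono[OF assms(1), of i] order_trans[of "xs ! i" _ v]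
      by (metis (mono_tags, lifting) lessThan_iff linorder_not_less mem_Collect_eq subsetI)
    then have "card ?J \<le> card {..<i}" by (intro card_mono) auto
    then show ?thesis by simp
  qed
  ultimately show ?thesis unfolding length_filter_conv_card by linarith
qed

text \<open>The j-th smallest entry is at most j exactly when at least j entries are. Counting
  replaces sorting, which suits diagonal shifts.\<close>

lemma parking_functions_iff:
  "a \<in> parking_functions k \<longleftrightarrow> (\<forall>i\<in>{1..k}. 1 \<le> a i) \<and> (\<forall>i. i \<notin> {1..k} \<longrightarrow> a i = 0) \<and>
    (\<forall>j\<in>{1..k}. j \<le> card {i\<in>{1..k}. a i \<le> j})"
proof -
  let ?xs = "map a [1..<k + 1]"
  have len: "length (filter (\<lambda>x. x \<le> j) (sort ?xs)) = card {i\<in>{1..k}. a i \<le> j}" for j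
  proof -
    have "length (filter (\<lambda>x. x \<le> j) (sort ?xs)) = length (filter (\<lambda>i. a i \<le> j) [1..<k + 1])"
      by (simp add: filter_sort filter_map comp_def del: upt_Suc)
    also have "\<dots> = card (set (filter (\<lambda>i. a i \<le> j) [1..<k + 1]))"
      by (rule distinct_card[symmetric]) simp
    also have "set (filter (\<lambda>i. a i \<le> j) [1..<k + 1]) = {i\<in>{1..k}. a i \<le> j}"
      by (auto simp del: upt_Suc)
    finally show ?thesis .
  qed
  have "sort ?xs ! (j - 1) \<le> j \<longleftrightarrow> j \<le> card {i\<in>{1..k}. a i \<le> j}" if "j \<in> {1..k}" for j
  proof -
    have "j - 1 < length (sort ?xs)" using that by (simp del: upt_Suc) linarith
    from sorted_nth_le_iff[OF sorted_sort this, of j] show ?thesis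
      using that unfolding len by auto
  qed
  then show ?thesis unfolding parking_functions_def by blast
qed

lemma parking_functions_le:
  assumes "a \<in> parking_functions k" "i \<in> {1..k}"
  shows "a i \<le> k"
proof -
  have "k \<le> card {i\<in>{1..k}. a i \<le> k}" using assms by (auto simp: parking_functions_iff)
  then have "{i\<in>{1..k}. a i \<le> k} = {1..k}" by (intro card_seteq) auto
  then show ?thesis using assms(2) by blast
qed

text \<open>Take the diagonal shift with the least sum of residues. Lowering it by j subtracts j
  from each of the n - 1 residues and returns n for each residue below j; minimality forces enough
  of these.\<close>

lemma parking_functions_shift_cong_exists:
  assumes n: "n \<ge> 1"
  shows "\<exists>a\<in>parking_functions (n - 1). shift_cong n (\<lambda>i. int (a i)) b"
proof -
  let ?I = "{1..n - 1}"
  obtain t where min: "\<And>s. nat (\<Sum>i\<in>?I. (b i + t) mod int n) \<le> nat (\<Sum>i\<in>?I. (b i + s) mod int n)"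
    using ex_has_least_nat[of "\<lambda>_. True" _ "\<lambda>s. nat (\<Sum>i\<in>?I. (b i + s) mod int n)"] by blast
  define r where "r i = (b i + t) mod int n" for i
  have r: "0 \<le> r i" "r i < int n" for i using n by (auto simp: r_def)
  \<comment> \<open>Residues start at 0 and parking functions at 1, so \<open>r i < j\<close>
    becomes \<open>a i \<le> j\<close>; the added 1 is one more diagonal shift.\<close>
  define a where "a i = (if i \<in> ?I then nat (r i) + 1 else 0)" for i
  have "j \<le> card {i\<in>?I. a i \<le> j}" if j: "j \<in> ?I" for j
  proof -
    let ?N = "card {i\<in>?I. a i \<le> j}"
    have "(b i + (t - int j)) mod int n = r i - int j + (if r i < int j then int n else 0)" for i
    proof -
      have "(b i + (t - int j)) mod int n = (r i - int j) mod int n"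
        unfolding r_def by (simp add: mod_diff_left_eq add_diff_eq)
      also have "\<dots> = (r i - int j + (if r i < int j then int n else 0)) mod int n" by simp
      also have "\<dots> = r i - int j + (if r i < int j then int n else 0)"
        using r[of i] j n by (intro mod_pos_pos_trivial) auto
      finally show ?thesis .
    qed
    then have "(\<Sum>i\<in>?I. (b i + (t - int j)) mod int n)
        = (\<Sum>i\<in>?I. r i) - (int n - 1) * int j + int n * int (card {i\<in>?I. r i < int j})"
      using n by (simp only: sum.distrib sum_subtractf sum.If_cases finite_atLeastAtMost)
        (simp add: Int_def of_nat_diff algebra_simps)
    also have "{i\<in>?I. r i < int j} = {i\<in>?I. a i \<le> j}"
      using r by (auto simp: a_def nat_less_iff Suc_le_eq)
    finally have "(\<Sum>i\<in>?I. (b i + (t - int j)) mod int n)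
      = (\<Sum>i\<in>?I. r i) - (int n - 1) * int j + int n * int ?N" .
    moreover have "0 \<le> (\<Sum>i\<in>?I. (b i + (t - int j)) mod int n)"
      by (rule sum_nonneg) (use n in simp)
    ultimately have "(int n - 1) * int j \<le> int n * int ?N"
      using min[of "t - int j"] unfolding r_def[symmetric] by linarith
    \<comment> \<open>The inequality (n - 1) j \<le> n N gives n (j - N) \<le> j < n, and
      integrality then yields j \<le> N.\<close>
    then have "int n * (int j - int ?N) \<le> int j" by (simp add: algebra_simps)
    moreover have "int j < int n" using j by auto
    ultimately have "int n * (int j - int ?N) < int n * 1" by linarith
    then have "int j - int ?N < 1" using n by (simp only: mult_less_cancel_left)
    then show ?thesis by simp
  qed
  then have "a \<in> parking_functions (n - 1)" by (auto simp: parking_functions_iff a_def)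
  moreover have "shift_cong n (\<lambda>i. int (a i)) b"
    unfolding shift_cong_def
  proof (intro exI ballI)
    fix i assume "i \<in> ?I"
    then have "int (a i) = (b i + t) mod int n + 1" using r[of i] by (simp add: a_def r_def)
    then show "[int (a i) = b i + (t + 1)] (mod int n)"
      using cong_add[OF cong_mod_left[THEN iffD2, OF cong_refl] cong_refl, of "b i + t" "int n" 1]
      by (simp add: add.assoc)
  qed
  ultimately show ?thesis by blast
qed

text \<open>If \<open>a\<close> were \<open>b\<close> shifted by t with 0 < t < n, then an entry of
  \<open>b\<close> that is at most n - t would become an entry of \<open>a\<close> above t. So the
  at least t positions with \<open>a i \<le> t\<close> and the at least n - t with
  \<open>b i \<le> n - t\<close> would be disjoint among n - 1 positions.\<close>

lemma parking_functions_shift_cong_unique: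
  assumes n: "n \<ge> 1" and a: "a \<in> parking_functions (n - 1)" and b: "b \<in> parking_functions (n - 1)"
    and ab: "shift_cong n (\<lambda>i. int (a i)) (\<lambda>i. int (b i))"
  shows "a = b"
proof -
  let ?I = "{1..n - 1}"
  obtain t' where t': "\<And>i. i \<in> ?I \<Longrightarrow> [int (a i) = int (b i) + t'] (mod int n)"
    using ab unfolding shift_cong_def by blast
  define t where "t = nat (t' mod int n)"
  have tn: "t < n" using n by (simp add: t_def nat_less_iff)
  have t: "[a i = b i + t] (mod n)" if "i \<in> ?I" for i
  proof -
    have "[int (b i) + t' = int (b i) + t' mod int n] (mod int n)"
      by (simp add: cong_def mod_add_right_eq)
    then have "[int (a i) = int (b i) + t' mod int n] (mod int n)" using t'[OF that] cong_trans by blast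
    moreover have "int (b i) + t' mod int n = int (b i + t)" using n by (simp add: t_def)
    ultimately show ?thesis by (simp only: cong_int_iff)
  qed
  have range: "1 \<le> a i" "a i < n" "1 \<le> b i" "b i < n" if "i \<in> ?I" for i
    using that a b parking_functions_le[OF a that] parking_functions_le[OF b that]
    by (auto simp: parking_functions_iff)
  have "t = 0"
  proof (rule ccontr)
    assume t0: "t \<noteq> 0"
    let ?A = "{i\<in>?I. a i \<le> t}" and ?B = "{i\<in>?I. b i \<le> n - t}"
    have "i \<notin> ?A" if i: "i \<in> ?B" for i
    proof -
      have I: "i \<in> ?I" using i by simp
      \<comment> \<open>Entries of \<open>a\<close> lie between 1 and n - 1, so none is divisible by
        n.\<close>
      have "b i + t \<noteq> n"
      proof
        assume "b i + t = n"
        then have "a i mod n = 0" using t[OF I] by (simp add: cong_def)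
        then show False using range[OF I] by simp
      qed
      then have "b i + t < n" using i tn by auto
      then have "a i = b i + t" using t[OF I] range[OF I] by (simp add: cong_def)
      then show ?thesis using range[OF I] by simp
    qed
    then have "card ?A + card ?B = card (?A \<union> ?B)" by (intro card_Un_disjoint[symmetric]) auto
    also have "\<dots> \<le> card ?I" by (rule card_mono) auto
    finally have "card ?A + card ?B \<le> n - 1" by simp
    moreover have "t \<in> ?I" "n - t \<in> ?I" using t0 tn by auto
    then have "t \<le> card ?A" "n - t \<le> card ?B"
      using a b unfolding parking_functions_iff by blast+
    ultimately show False using tn by linarith
  qed
  then have "a i = b i" if "i \<in> ?I" for i
    using t[OF that] range[OF that] by (simp add: cong_def)
  moreover have "a i = b i" if "i \<notin> ?I" for i
    using a b that unfolding parking_functions_iff by (metis (no_types))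
  ultimately show ?thesis by blast
qed

section \<open>The equivariant bijection between lattice points and parking functions\<close>

theorem theorem1p1:
  fixes n :: nat
  assumes "n \<ge> 2"
  shows "rep_isomorphic
    (restrict_rep (stabilizer (sym_group n) (\<lambda>p. p) n) (gamma_rep n)) (Park (n - 1))"
proof -
  let ?X = "Lat (delta_polytope n)" and ?Y = "parking_functions (n - 1)"
  let ?H = "stabilizer (sym_group n) (\<lambda>p. p) n"
  have n1: "n \<ge> 1" using assms by simp
  have H: "(sym_group n)\<lparr>carrier := ?H\<rparr> = sym_group (n - 1)"
    using n1 by (rule group_stabilizer_sym_group)
  \<comment> \<open>The floor only returns real lattice points to integer vectors.\<close>
  define R where "R x a \<longleftrightarrow> shift_cong n (\<lambda>i. \<lfloor>x i\<rfloor>) (\<lambda>i. int (a i))"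
    for x :: "nat \<Rightarrow> real" and a :: "nat \<Rightarrow> nat"
  define F where "F x = (THE a. a \<in> ?Y \<and> R x a)" for x
  have R1: "\<exists>!a. a \<in> ?Y \<and> R x a" for x
  proof (rule ex_ex1I)
    show "\<exists>a. a \<in> ?Y \<and> R x a"
      using parking_functions_shift_cong_exists[OF n1] shift_cong_sym unfolding R_def by blast
    show "a = b" if "a \<in> ?Y \<and> R x a" "b \<in> ?Y \<and> R x b" for a b
      using that parking_functions_shift_cong_unique[OF n1] shift_cong_sym shift_cong_trans
      unfolding R_def by blast
  qed
  have "\<exists>!x. x \<in> ?X \<and> R x a" for a
  proof (rule ex_ex1I)
    obtain x where "x \<in> permutohedron_points n" "shift_cong n x (\<lambda>i. int (a i))"
      using permutohedron_points_shift_cong_exists[OF assms] by blast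
    then show "\<exists>x. x \<in> ?X \<and> R x a"
      unfolding Lat_delta_polytope[OF assms] R_def
      by (intro exI[of _ "\<lambda>i. real_of_int (x i)"]) simp
    fix x y assume xy: "x \<in> ?X \<and> R x a" "y \<in> ?X \<and> R y a"
    then obtain x' y' where "x' \<in> permutohedron_points n" "x = (\<lambda>i. real_of_int (x' i))"
      "y' \<in> permutohedron_points n" "y = (\<lambda>i. real_of_int (y' i))"
      unfolding Lat_delta_polytope[OF assms] by blast
    moreover have "shift_cong n (\<lambda>i. \<lfloor>x i\<rfloor>) (\<lambda>i. \<lfloor>y i\<rfloor>)"
      using xy shift_cong_sym shift_cong_trans unfolding R_def by blast
    ultimately show "x = y"
      using permutohedron_points_shift_cong_unique[OF assms, of x' y'] by simp
  qed
  with R1 have bij: "bij_betw F ?X ?Y"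
    unfolding F_def by (intro bij_betw_THE)
  have X: "group_action (sym_group n) ?X (coord_action ?X)"
    by (rule group_action_coord_action) (auto simp: Lat_def intro: delta_polytope_permute)
  have Y: "group_action (sym_group (n - 1)) ?Y (coord_action ?Y)"
    by (rule group_action_coord_action) (rule parking_functions_permute)
  have equiv: "F (coord_action ?X h x) = coord_action ?Y h (F x)"
    if h: "h \<in> ?H" and x: "x \<in> ?X" for h x
  proof -
    \<comment> \<open>Permutations fixing n permute the first n - 1 positions, the only ones that
      \<open>shift_cong\<close> compares.\<close>
    have "h \<in> carrier (sym_group (n - 1))" unfolding H[symmetric] using h by simp
    then have p: "inv' h permutes {1..n - 1}" by (simp add: sym_group_def permutes_inv)
    have F: "F x \<in> ?Y" "R x (F x)" using theI'[OF R1] unfolding F_def by blast+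
    then have "F x \<circ> inv' h \<in> ?Y" using p by (intro parking_functions_permute)
    moreover have "R (x \<circ> inv' h) (F x \<circ> inv' h)"
      using shift_cong_permute[OF p F(2)[unfolded R_def]] by (simp add: R_def comp_def)
    ultimately have "F (x \<circ> inv' h) = F x \<circ> inv' h"
      unfolding F_def[of "x \<circ> inv' h"] by (intro the1_equality R1 conjI)
    then show ?thesis using x F(1) by (simp add: coord_action_def)
  qed
  show ?thesis
    using rep_isomorphic_restrict_perm_rep[OF X subgroup_stabilizer_sym_group[OF n1],
        unfolded H, OF Y bij equiv]
    unfolding gamma_rep_def Park_def .
qed

end
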